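(* Let $\Sigma$ be a finite alphabet containing a letter $a$. The monoid $\widetilde{\Sigma}^*$ contains nontrivial idempotents: the element $E=[(a^{\lfloor\varepsilon^{-1}\rfloor})_\varepsilon]$ satisfies $E^2=E$ and $E\neq\mathbf{1}$.
   Context: $\Sigma^*$ is the free monoid of finite words over $\Sigma$ under concatenation, $\lambda$ is the empty word, $|w|$ is the length of $w$. For $u\neq v$ in $\Sigma^*$, $\operatorname{lcp}(u,v)$ and $\operatorname{lcs}(u,v)$ are the lengths of the longest common prefix and of the longest common suffix of $u,v$; by convention $\operatorname{lcp}(u,u)=\operatorname{lcs}(u,u)=+\infty$. A net of words is a family $(w_\varepsilon)_{\varepsilon\in(0,1]}$ of words in $\Sigma^*$. It is moderate if there exist $N\in\mathbb{N}$, $C>0$, $\varepsilon_0>0$ with $|w_\varepsilon|\le C\varepsilon^{-N}$ for all $\varepsilon<\varepsilon_0$. $\mathcal{E}_M(\Sigma^* )$ is the set of moderate nets. Two moderate nets are equivalent, $(u_\varepsilon)\sim(v_\varepsilon)$, if for every $m\in\mathbb{N}$ there exists $\varepsilon_0>0$ such that $\min\{\operatorname{lcp}(u_\varepsilon,v_\varepsilon),\operatorname{lcs}(u_\varepsilon,v_\varepsilon)\}\ge m\log_2(1/\varepsilon)$ for all $\varepsilon<\varepsilon_0$; this is an equivalence relation. $\widetilde{\Sigma}^*:=\mathcal{E}_M(\Sigma^* )/\sim$ is a monoid under the well-defined product $[(u_\varepsilon)]\cdot[(v_\varepsilon)]:=[(u_\varepsilon v_\varepsilon)]$, with identity $\mathbf{1}=[(\lambda)_\varepsilon]$.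 *)

theory Defs
  imports Complex_Main "HOL-Library.Sublist" "HOL-Library.Extended_Real"
begin

text \<open>An alphabet \<open>\<Sigma>\<close> is rendered as a type \<^typ>\<open>'a\<close> and a word over it as an element of
  \<^typ>\<open>'a list\<close>; a finite alphabet is a type of class \<^class>\<open>finite\<close>.\<close>

definition lcp :: "'a list \<Rightarrow> 'a list \<Rightarrow> ereal" where
  "lcp u v = (if u = v then \<infinity> else ereal (real (length (longest_common_prefix u v))))"

text \<open>Reversal turns suffixes into prefixes.\<close>

definition lcs :: "'a list \<Rightarrow> 'a list \<Rightarrow> ereal" where
  "lcs u v = lcp (rev u) (rev v)"

text \<open>A net \<open>(w\<^sub>\<epsilon>)\<close> with \<open>\<epsilon> \<in> (0,1]\<close> is a function on the reals of which only the values
  on \<open>(0,1]\<close> are ever inspected; nets that agree there are identified by the equivalence below.\<close>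

definition moderate :: "(real \<Rightarrow> 'a list) \<Rightarrow> bool" where
  "moderate w \<longleftrightarrow> (\<exists>N::nat. \<exists>C>0. \<exists>\<epsilon>\<^sub>0>0. \<forall>\<epsilon>\<in>{0<..1}. \<epsilon> < \<epsilon>\<^sub>0 \<longrightarrow>
     real (length (w \<epsilon>)) \<le> C * \<epsilon> powi (- int N))"

definition net_equiv :: "(real \<Rightarrow> 'a list) \<Rightarrow> (real \<Rightarrow> 'a list) \<Rightarrow> bool" where
  "net_equiv u v \<longleftrightarrow> (\<forall>m::nat. \<exists>\<epsilon>\<^sub>0>0. \<forall>\<epsilon>\<in>{0<..1}. \<epsilon> < \<epsilon>\<^sub>0 \<longrightarrow>
     min (lcp (u \<epsilon>) (v \<epsilon>)) (lcs (u \<epsilon>) (v \<epsilon>)) \<ge> ereal (real m * log 2 (1 / \<epsilon>)))"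

lemma lcp_self [simp]: "lcp u u = \<infinity>"
  by (simp add: lcp_def)

lemma lcp_commute: "lcp u v = lcp v u"
proof -
  have "length (longest_common_prefix u v) = length (longest_common_prefix v u)"
    by (induction u v rule: longest_common_prefix.induct) auto
  then show ?thesis by (simp add: lcp_def eq_commute)
qed

lemma lcp_geI:
  assumes "prefix p u" "prefix p v"
  shows "ereal (real (length p)) \<le> lcp u v"
proof -
  have "prefix p (longest_common_prefix u v)"
    using assms by (rule longest_common_prefix_max_prefix)
  then show ?thesis by (auto simp: lcp_def dest: prefix_length_le)
qed

lemma lcp_cases:
  obtains "u = v"
  | p where "prefix p u" "prefix p v" "lcp u v = ereal (real (length p))"
proof (cases "u = v")
  case False
  show ?thesis
    by (rule that(2)[of "longest_common_prefix u v"])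
      (use False in \<open>simp_all add: lcp_def longest_common_prefix_prefix1
        longest_common_prefix_prefix2\<close>)
qed (use that in auto)

lemma lcp_ultrametric: "min (lcp u v) (lcp v w) \<le> lcp u w"
proof (cases u v rule: lcp_cases)
  case 1
  then show ?thesis by simp
next
  case p: (2 p)
  show ?thesis
  proof (cases v w rule: lcp_cases)
    case 1
    then show ?thesis by simp
  next
    case q: (2 q)
    have "prefix p q \<or> prefix q p"
      using p(2) q(1) prefix_same_cases by blast
    then show ?thesis
    proof
      assume "prefix p q"
      then have "prefix p w" using q(2) prefix_order.trans by blast
      then have "lcp u v \<le> lcp u w" using lcp_geI[OF p(1)] p(3) by simp
      then show ?thesis by (simp add: min.coboundedI1)
    next
      assume "prefix q p"
      then have "prefix q u" using p(1) prefix_order.trans by blast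
      then have "lcp v w \<le> lcp u w" using lcp_geI[OF _ q(2)] q(3) by simp
      then show ?thesis by (simp add: min.coboundedI2)
    qed
  qed
qed

lemma lcp_append_right: "lcp u v \<le> lcp (u @ x) (v @ x)"
proof (cases u v rule: lcp_cases)
  case (2 p)
  then show ?thesis using lcp_geI[of p "u @ x" "v @ x"] by (simp add: prefix_prefix)
qed auto

lemma lcp_append_left: "lcp u v \<le> lcp (x @ u) (x @ v)"
proof (cases u v rule: lcp_cases)
  case (2 p)
  have "ereal (real (length p)) \<le> ereal (real (length (x @ p)))" by simp
  also have "\<dots> \<le> lcp (x @ u) (x @ v)" by (rule lcp_geI) (use 2 in auto)
  finally show ?thesis using 2 by simp
qed auto

lemma lcp_append: "min (lcp u v) (lcp u' v') \<le> lcp (u @ u') (v @ v')"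
  using lcp_ultrametric[of "u @ u'" "v @ u'" "v @ v'"]
    lcp_append_right[of u v u'] lcp_append_left[of u' v' v]
  by (meson min.mono order_trans)

lemma lcs_append: "min (lcs u v) (lcs u' v') \<le> lcs (u @ u') (v @ v')"
  using lcp_append[of "rev u'" "rev v'" "rev u" "rev v"] by (simp add: lcs_def min.commute)

lemma net_equiv_refl: "net_equiv u u"
  unfolding net_equiv_def lcs_def by (simp, rule exI[of _ 1], simp)

lemma net_equiv_sym: "net_equiv u v \<Longrightarrow> net_equiv v u"
  by (simp add: net_equiv_def lcs_def lcp_commute)

lemma net_equiv_combine:
  assumes "net_equiv u v" "net_equiv u' v'"
  assumes "\<And>\<epsilon>. min (lcp (u \<epsilon>) (v \<epsilon>)) (lcp (u' \<epsilon>) (v' \<epsilon>)) \<le> lcp (x \<epsilon>) (y \<epsilon>)"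
  assumes "\<And>\<epsilon>. min (lcs (u \<epsilon>) (v \<epsilon>)) (lcs (u' \<epsilon>) (v' \<epsilon>)) \<le> lcs (x \<epsilon>) (y \<epsilon>)"
  shows "net_equiv x y"
  unfolding net_equiv_def
proof
  fix m :: nat
  obtain d where d: "d > 0" "\<And>\<epsilon>. \<epsilon> \<in> {0<..1} \<Longrightarrow> \<epsilon> < d \<Longrightarrow>
      min (lcp (u \<epsilon>) (v \<epsilon>)) (lcs (u \<epsilon>) (v \<epsilon>)) \<ge> ereal (real m * log 2 (1 / \<epsilon>))"
    using assms(1) unfolding net_equiv_def by blast
  obtain e where e: "e > 0" "\<And>\<epsilon>. \<epsilon> \<in> {0<..1} \<Longrightarrow> \<epsilon> < e \<Longrightarrow>
      min (lcp (u' \<epsilon>) (v' \<epsilon>)) (lcs (u' \<epsilon>) (v' \<epsilon>)) \<ge> ereal (real m * log 2 (1 / \<epsilon>))"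
    using assms(2) unfolding net_equiv_def by blast
  have "min (lcp (x \<epsilon>) (y \<epsilon>)) (lcs (x \<epsilon>) (y \<epsilon>)) \<ge> ereal (real m * log 2 (1 / \<epsilon>))"
    if "\<epsilon> \<in> {0<..1}" "\<epsilon> < min d e" for \<epsilon>
  proof -
    have "ereal (real m * log 2 (1 / \<epsilon>)) \<le> min (lcp (u \<epsilon>) (v \<epsilon>)) (lcp (u' \<epsilon>) (v' \<epsilon>))"
      "ereal (real m * log 2 (1 / \<epsilon>)) \<le> min (lcs (u \<epsilon>) (v \<epsilon>)) (lcs (u' \<epsilon>) (v' \<epsilon>))"
      using d(2)[OF that(1)] e(2)[OF that(1)] that(2) by simp_all
    then show ?thesis
      using order_trans[OF _ assms(3)] order_trans[OF _ assms(4)] by simp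
  qed
  then show "\<exists>\<epsilon>\<^sub>0>0. \<forall>\<epsilon>\<in>{0<..1}. \<epsilon> < \<epsilon>\<^sub>0 \<longrightarrow>
      min (lcp (x \<epsilon>) (y \<epsilon>)) (lcs (x \<epsilon>) (y \<epsilon>)) \<ge> ereal (real m * log 2 (1 / \<epsilon>))"
    using d(1) e(1) by (intro exI[of _ "min d e"]) auto
qed

lemma net_equiv_trans: "net_equiv u v \<Longrightarrow> net_equiv v w \<Longrightarrow> net_equiv u w"
  by (erule (1) net_equiv_combine) (simp_all only: lcs_def lcp_ultrametric)

lemma net_equiv_append:
  "net_equiv u v \<Longrightarrow> net_equiv u' v' \<Longrightarrow> net_equiv (\<lambda>\<epsilon>. u \<epsilon> @ u' \<epsilon>) (\<lambda>\<epsilon>. v \<epsilon> @ v' \<epsilon>)"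
  by (erule (1) net_equiv_combine) (rule lcp_append lcs_append)+

lemma moderate_Nil: "moderate (\<lambda>_. [])"
proof -
  have "\<forall>\<epsilon>\<in>{0<..1::real}. \<epsilon> < 1 \<longrightarrow>
      real (length ([] :: 'a list)) \<le> 1 * \<epsilon> powi (- int 0)" by simp
  then show ?thesis unfolding moderate_def using zero_less_one by blast
qed

lemma moderate_append:
  assumes "moderate u" "moderate v"
  shows "moderate (\<lambda>\<epsilon>. u \<epsilon> @ v \<epsilon>)"
proof -
  obtain N C d where u: "C > 0" "d > 0" "\<And>\<epsilon>. \<epsilon> \<in> {0<..1} \<Longrightarrow> \<epsilon> < d \<Longrightarrow>
      real (length (u \<epsilon>)) \<le> C * \<epsilon> powi (- int N)"
    using assms(1) unfolding moderate_def by blast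
  obtain M D e where v: "D > 0" "e > 0" "\<And>\<epsilon>. \<epsilon> \<in> {0<..1} \<Longrightarrow> \<epsilon> < e \<Longrightarrow>
      real (length (v \<epsilon>)) \<le> D * \<epsilon> powi (- int M)"
    using assms(2) unfolding moderate_def by blast
  have "real (length (u \<epsilon> @ v \<epsilon>)) \<le> (C + D) * \<epsilon> powi (- int (max N M))"
    if "\<epsilon> \<in> {0<..1}" "\<epsilon> < min d e" for \<epsilon>
  proof -
    have mono: "\<epsilon> powi (- int k) \<le> \<epsilon> powi (- int l)" if "k \<le> l" for k l
      using \<open>\<epsilon> \<in> {0<..1}\<close> that
      by (simp add: power_int_minus power_decreasing le_imp_inverse_le)
    have "real (length (u \<epsilon>)) \<le> C * \<epsilon> powi (- int (max N M))"
      using order_trans[OF u(3) mult_left_mono[OF mono[of N "max N M"], of C]] that u(1) by simp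
    moreover have "real (length (v \<epsilon>)) \<le> D * \<epsilon> powi (- int (max N M))"
      using order_trans[OF v(3) mult_left_mono[OF mono[of M "max N M"], of D]] that v(1) by simp
    ultimately show ?thesis by (simp add: distrib_right)
  qed
  moreover have "C + D > 0" "min d e > 0" using u(1,2) v(1,2) by auto
  ultimately show ?thesis unfolding moderate_def by blast
qed

text \<open>The quotient of the moderate nets by the equivalence. For a moderate net \<open>w\<close>, the class
  \<open>[(w\<^sub>\<epsilon>)]\<close> is \<open>abs_gword w\<close>; on nets that are not moderate \<open>abs_gword\<close> carries no meaning.\<close>

quotient_type 'a gword = "real \<Rightarrow> 'a list" / partial:
  "\<lambda>u v. moderate u \<and> moderate v \<and> net_equiv u v"
proof (rule part_equivpI)
  show "\<exists>u :: real \<Rightarrow> 'a list. moderate u \<and> moderate u \<and> net_equiv u u"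
    using moderate_Nil net_equiv_refl by blast
qed (blast intro: sympI transpI net_equiv_sym net_equiv_trans)+

instantiation gword :: (type) monoid_mult
begin

lift_definition one_gword :: "'a gword" is "\<lambda>_. []"
  by (simp add: moderate_Nil net_equiv_refl)

lift_definition times_gword :: "'a gword \<Rightarrow> 'a gword \<Rightarrow> 'a gword" is "\<lambda>u v \<epsilon>. u \<epsilon> @ v \<epsilon>"
  by (simp add: moderate_append net_equiv_append)

instance
  by (standard; transfer) (simp_all add: moderate_append net_equiv_refl)

end

end

theory Submission
  imports Defs "HOL-Real_Asymp.Real_Asymp"
begin

text \<open>The words \<open>a\<^sup>n\<close> and \<open>a\<^sup>n a\<^sup>n = a\<^bsup>2n\<^esup>\<close> agree on at least \<open>n\<close> letters at both ends.
  Equivalence only asks that the agreement at both ends outgrow every multiple of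
  \<open>log\<^sub>2 (1/\<epsilon>)\<close>, and \<open>n = \<lfloor>1/\<epsilon>\<rfloor>\<close> does, so the doubled length is not seen by the quotient and
  \<open>E\<^sup>2 = E\<close> (lemma \<open>net_equiv_replicate\<close>). On the other hand a nonempty word shares no letter
  with the empty word, so that \<open>E = 1\<close> would force \<open>log\<^sub>2 (1/\<epsilon>) \<le> 0\<close> for small \<open>\<epsilon>\<close>, which
  fails (lemma \<open>not_net_equiv_Nil\<close>).\<close>

text \<open>In filter form, the thresholds of several asymptotic conditions need not be merged by hand,
  and comparisons of concrete functions of \<open>\<epsilon>\<close> can be automated.\<close>

lemma net_equiv_iff_eventually:
  "net_equiv u v \<longleftrightarrow> (\<forall>m::nat. \<forall>\<^sub>F \<epsilon> in at_right 0.
     ereal (real m * log 2 (1 / \<epsilon>)) \<le> min (lcp (u \<epsilon>) (v \<epsilon>)) (lcs (u \<epsilon>) (v \<epsilon>)))"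
proof -
  \<comment> \<open>The restriction to \<open>\<epsilon> \<le> 1\<close> disappears by shrinking the threshold below 1.\<close>
  have "(\<exists>d>0. \<forall>\<epsilon>\<in>{0<..1}. \<epsilon> < d \<longrightarrow> P \<epsilon>) \<longleftrightarrow> (\<forall>\<^sub>F \<epsilon> in at_right 0. P \<epsilon>)"
    for P :: "real \<Rightarrow> bool"
  proof
    assume "\<exists>d>0. \<forall>\<epsilon>\<in>{0<..1}. \<epsilon> < d \<longrightarrow> P \<epsilon>"
    then obtain d where "d > 0" "\<forall>\<epsilon>\<in>{0<..1}. \<epsilon> < d \<longrightarrow> P \<epsilon>" by blast
    then show "\<forall>\<^sub>F \<epsilon> in at_right 0. P \<epsilon>"
      unfolding eventually_at_right_field by (intro exI[of _ "min d 1"]) auto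
  qed (auto simp: eventually_at_right_field)
  then show ?thesis unfolding net_equiv_def by simp
qed

lemma lcp_replicate: "ereal (real (min k l)) \<le> lcp (replicate k a) (replicate l a)"
proof -
  have "prefix (replicate (min k l) a) (replicate j a)" if "min k l \<le> j" for j
    using that by (metis le_add_diff_inverse prefixI replicate_add)
  then show ?thesis using lcp_geI[of "replicate (min k l) a"] by simp
qed

text \<open>A power of a single letter is its own reversal.\<close>

lemma lcs_replicate: "ereal (real (min k l)) \<le> lcs (replicate k a) (replicate l a)"
  using lcp_replicate by (simp add: lcs_def)

text \<open>Two powers of the same letter cannot disagree before the shorter one ends, from either
  side, so only the growth of the smaller exponent matters.\<close>

lemma net_equiv_replicate:
  assumes "\<And>m::nat. \<forall>\<^sub>F \<epsilon> in at_right 0. real m * log 2 (1 / \<epsilon>) \<le> real (min (k \<epsilon>) (l \<epsilon>))"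
  shows "net_equiv (\<lambda>\<epsilon>. replicate (k \<epsilon>) a) (\<lambda>\<epsilon>. replicate (l \<epsilon>) a)"
  unfolding net_equiv_iff_eventually
proof
  fix m :: nat
  show "\<forall>\<^sub>F \<epsilon> in at_right 0. ereal (real m * log 2 (1 / \<epsilon>))
      \<le> min (lcp (replicate (k \<epsilon>) a) (replicate (l \<epsilon>) a))
          (lcs (replicate (k \<epsilon>) a) (replicate (l \<epsilon>) a))"
    using assms[of m]
  proof eventually_elim
    case (elim \<epsilon>)
    then have "ereal (real m * log 2 (1 / \<epsilon>)) \<le> ereal (real (min (k \<epsilon>) (l \<epsilon>)))" by simp
    then show ?case
      by (meson lcp_replicate lcs_replicate min.boundedI order_trans)
  qed
qed

text \<open>A nonempty word agrees with the empty word on 0 letters, so the condition for \<open>m = 1\<close> already fails.\<close>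

lemma not_net_equiv_Nil:
  assumes "\<forall>\<^sub>F \<epsilon> in at_right 0. w \<epsilon> \<noteq> []"
  shows "\<not> net_equiv w (\<lambda>_. [])"
proof
  assume "net_equiv w (\<lambda>_. [])"
  then have "\<forall>\<^sub>F \<epsilon> in at_right 0.
      ereal (real 1 * log 2 (1 / \<epsilon>)) \<le> min (lcp (w \<epsilon>) []) (lcs (w \<epsilon>) [])"
    unfolding net_equiv_iff_eventually by blast
  moreover have "\<forall>\<^sub>F \<epsilon> in at_right 0. 0 < log 2 (1 / \<epsilon> :: real)" by real_asymp
  ultimately have "\<forall>\<^sub>F \<epsilon> in at_right (0::real). False"
    using assms
  proof eventually_elim
    case (elim \<epsilon>)
    have "longest_common_prefix (w \<epsilon>) [] = []" by (cases "w \<epsilon>") auto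
    then have "lcp (w \<epsilon>) [] = 0" using elim(3) by (simp add: lcp_def zero_ereal_def)
    then have "ereal (log 2 (1 / \<epsilon>)) \<le> 0" using elim(1) by simp
    then show ?case using elim(2) by (simp add: zero_ereal_def)
  qed
  then show False by simp
qed

lemma log_le_nat_floor:
  "\<forall>\<^sub>F \<epsilon> in at_right 0. real m * log 2 (1 / \<epsilon>) \<le> real (nat \<lfloor>1 / \<epsilon>\<rfloor>)"
proof -
  have "\<forall>\<^sub>F \<epsilon> in at_right 0. real m * log 2 (1 / \<epsilon>) \<le> 1 / \<epsilon> - 1" by real_asymp
  then show ?thesis by eventually_elim linarith
qed

lemma moderate_replicate_floor: "moderate (\<lambda>\<epsilon>. replicate (nat \<lfloor>1 / \<epsilon>\<rfloor>) a)"
proof -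
  have "real (length (replicate (nat \<lfloor>1 / \<epsilon>\<rfloor>) a)) \<le> 1 * \<epsilon> powi (- int 1)"
    if "\<epsilon> \<in> {0<..1}" for \<epsilon> :: real
    using that by (simp add: power_int_minus inverse_eq_divide)
  then show ?thesis unfolding moderate_def using zero_less_one by blast
qed

lemma abs_gword_eq_iff:
  assumes "moderate u" "moderate v"
  shows "abs_gword u = abs_gword v \<longleftrightarrow> net_equiv u v"
  using Quotient3_rel[OF Quotient3_gword, of u v] assms by (simp add: net_equiv_refl)

theorem mainTheorem12:
  fixes a :: "'a::finite"
  shows "moderate (\<lambda>\<epsilon>. replicate (nat \<lfloor>1 / \<epsilon>\<rfloor>) a) \<and>
    (let E = abs_gword (\<lambda>\<epsilon>. replicate (nat \<lfloor>1 / \<epsilon>\<rfloor>) a)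
     in E ^ 2 = E \<and> E \<noteq> 1)"
proof -
  define n :: "real \<Rightarrow> nat" where "n \<epsilon> = nat \<lfloor>1 / \<epsilon>\<rfloor>" for \<epsilon>
  define w where "w \<epsilon> = replicate (n \<epsilon>) a" for \<epsilon>
  have w: "moderate w" unfolding w_def n_def by (rule moderate_replicate_floor)
  have "net_equiv (\<lambda>\<epsilon>. replicate (n \<epsilon> + n \<epsilon>) a) w"
    unfolding w_def by (rule net_equiv_replicate) (simp add: n_def log_le_nat_floor)
  then have "net_equiv (\<lambda>\<epsilon>. w \<epsilon> @ w \<epsilon>) w" by (simp add: w_def replicate_add)
  then have "abs_gword (\<lambda>\<epsilon>. w \<epsilon> @ w \<epsilon>) = abs_gword w"
    using w by (simp add: abs_gword_eq_iff moderate_append)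
  then have idem: "abs_gword w ^ 2 = abs_gword w"
    using w by (simp add: power2_eq_square times_gword.abs_eq net_equiv_refl)
  have "\<forall>\<^sub>F \<epsilon> in at_right 0. 1 \<le> 1 / (\<epsilon> :: real)" by real_asymp
  then have "\<forall>\<^sub>F \<epsilon> in at_right 0. w \<epsilon> \<noteq> []"
    by eventually_elim (simp add: w_def n_def)
  then have "abs_gword w \<noteq> 1"
    using w by (simp add: one_gword_def abs_gword_eq_iff moderate_Nil not_net_equiv_Nil)
  moreover have "w = (\<lambda>\<epsilon>. replicate (nat \<lfloor>1 / \<epsilon>\<rfloor>) a)" by (simp add: fun_eq_iff w_def n_def)
  ultimately show ?thesis using w idem by (simp add: Let_def)
qed

end
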